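(* Let $R_f=\mathbb{S}^1=\{(x,y)\in\mathbb{R}^2: x^2+y^2=1\}$ be the Reeb graph with Reeb function $\tilde f(x,y)=x$, and let $R_g=[-1,1]$ be the Reeb graph with Reeb function $\tilde g(t)=t$. Then the interleaving distance $d_I$ and the functional distortion distance $d_{FD}$ satisfy $$d_I(R_f,R_g)\le d_{FD}(R_f,R_g)\le\tfrac12.$$
   Context: All maps are continuous. For a Reeb graph $R_f$ with Reeb function $\tilde f:R_f\to\mathbb{R}$, define a metric on $R_f$ by $$d_f(x,y)=\inf\{b-a \mid x,y\text{ are in the same connected component of }\tilde f^{-1}([a,b])\}.$$ Given maps $\phi:R_f\to R_g$ and $\psi:R_g\to R_f$, let $$G(\phi,\psi)=\{(p,\phi(p)):p\in R_f\}\cup\{(\psi(q),q):q\in R_g\}\subseteq R_f\times R_g.$$ The functional distortion distance is $$d_{FD}(R_f,R_g)=\inf_{\phi,\psi}\max\Big\{\sup_{(p,q),(p',q')\in G(\phi,\psi)}\tfrac12|d_f(p,p')-d_g(q,q')|,\ \|\tilde f-\tilde g\circ\phi\|_\infty,\ \|\tilde f\circ\psi-\tilde g\|_\infty\Big\},$$ the infimum being over all continuous maps $\phi:R_f\to R_g$, $\psi:R_g\to R_f$. Interleaving distance (de Silva, Munch, Patel): let $\mathbf{Int}$ be the poset of bounded open intervals of $\mathbb{R}$ ordered by inclusion, and for $I=(a,b)$ let $I^\varepsilon=(a-\varepsilon,b+\varepsilon)$. To a Reeb graph $R_f$ associate the functor $F:\mathbf{Int}\to\mathbf{Set}$, $F(I)=\pi_0(\tilde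 f^{-1}(I))$, with maps induced by inclusion; let $G$ be the functor associated in the same way to $R_g$. An $\varepsilon$-interleaving consists of families of maps $\alpha_I:F(I)\to G(I^\varepsilon)$ and $\beta_I:G(I)\to F(I^\varepsilon)$, natural in $I$, such that $\beta_{I^\varepsilon}\circ\alpha_I=F(I\subseteq I^{2\varepsilon})$ and $\alpha_{I^\varepsilon}\circ\beta_I=G(I\subseteq I^{2\varepsilon})$ for all $I$. Then $d_I(R_f,R_g)$ is the infimum of all $\varepsilon\ge0$ for which an $\varepsilon$-interleaving exists. *)

theory Defs
  imports "HOL-Analysis.Analysis"
begin

text \<open>
  A Reeb graph with its Reeb function is given by a carrier set \<open>X\<close> in a topological space,
  carrying the subspace topology, and a real function \<open>f\<close>, of which only the values on \<open>X\<close> matter.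
  Nothing below asks \<open>X\<close> to be a graph.
\<close>

abbreviation preim :: "'a set \<Rightarrow> ('a \<Rightarrow> real) \<Rightarrow> real set \<Rightarrow> 'a set" where
  "preim X f I \<equiv> {x \<in> X. f x \<in> I}"

text \<open>
  The infimum is taken in the reals. The set is bounded below by 0; it is nonempty for all points
  \<open>x\<close>, \<open>y\<close> of \<open>X\<close> when \<open>X\<close> is connected and \<open>f\<close> is bounded on \<open>X\<close>, and should not be relied on otherwise.
\<close>

definition reeb_dist :: "'a::topological_space set \<Rightarrow> ('a \<Rightarrow> real) \<Rightarrow> 'a \<Rightarrow> 'a \<Rightarrow> real" where
  "reeb_dist X f x y = Inf {b - a | a b. connected_component (preim X f {a..b}) x y}"

definition graph_corr ::
    "'a set \<Rightarrow> 'b set \<Rightarrow> ('a \<Rightarrow> 'b) \<Rightarrow> ('b \<Rightarrow> 'a) \<Rightarrow> ('a \<times> 'b) set" where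
  "graph_corr X Y \<phi> \<psi> = {(p, \<phi> p) | p. p \<in> X} \<union> {(\<psi> q, q) | q. q \<in> Y}"

definition sup_dist :: "'a set \<Rightarrow> ('a \<Rightarrow> real) \<Rightarrow> ('a \<Rightarrow> real) \<Rightarrow> ereal" where
  "sup_dist X u v = (SUP x\<in>X. ereal \<bar>u x - v x\<bar>)"

definition fd_distortion ::
    "'a::topological_space set \<Rightarrow> ('a \<Rightarrow> real) \<Rightarrow> 'b::topological_space set \<Rightarrow> ('b \<Rightarrow> real) \<Rightarrow>
     ('a \<Rightarrow> 'b) \<Rightarrow> ('b \<Rightarrow> 'a) \<Rightarrow> ereal" where
  "fd_distortion X f Y g \<phi> \<psi> =
     (SUP ((p, q), (p', q')) \<in> graph_corr X Y \<phi> \<psi> \<times> graph_corr X Y \<phi> \<psi>.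
        ereal (1 / 2 * \<bar>reeb_dist X f p p' - reeb_dist Y g q q'\<bar>))"

definition d_FD ::
    "'a::topological_space set \<Rightarrow> ('a \<Rightarrow> real) \<Rightarrow> 'b::topological_space set \<Rightarrow> ('b \<Rightarrow> real) \<Rightarrow> ereal" where
  "d_FD X f Y g =
     (INF (\<phi>, \<psi>) \<in> {(\<phi>, \<psi>). continuous_on X \<phi> \<and> \<phi> ` X \<subseteq> Y \<and> continuous_on Y \<psi> \<and> \<psi> ` Y \<subseteq> X}.
        Max {fd_distortion X f Y g \<phi> \<psi>, sup_dist X f (g \<circ> \<phi>), sup_dist Y (f \<circ> \<psi>) g})"

text \<open>
  The object \<open>(a, b)\<close> of \<open>Int\<close> is encoded by its endpoints \<open>a < b\<close>, so that \<open>(a, b) \<subseteq> (c, d)\<close>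
  reads \<open>c \<le> a \<and> b \<le> d\<close>. The elements of \<open>\<pi>\<^sub>0\<close> are the path components themselves.
\<close>

definition reeb_pi0 ::
    "'a::topological_space set \<Rightarrow> ('a \<Rightarrow> real) \<Rightarrow> real \<Rightarrow> real \<Rightarrow> 'a set set" where
  "reeb_pi0 X f a b = path_components_of (top_of_set (preim X f {a<..<b}))"

text \<open>
  The map induced by \<open>I \<subseteq> (c, d)\<close> sends a component over \<open>I\<close> to the component over \<open>(c, d)\<close>
  containing it; it does not depend on \<open>I\<close> otherwise.
\<close>

definition reeb_pi0_map ::
    "'a::topological_space set \<Rightarrow> ('a \<Rightarrow> real) \<Rightarrow> real \<Rightarrow> real \<Rightarrow> 'a set \<Rightarrow> 'a set" where
  "reeb_pi0_map X f c d C = (THE D. D \<in> reeb_pi0 X f c d \<and> C \<subseteq> D)"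

definition natural_shift ::
    "real \<Rightarrow> 'a::topological_space set \<Rightarrow> ('a \<Rightarrow> real) \<Rightarrow> 'b::topological_space set \<Rightarrow> ('b \<Rightarrow> real) \<Rightarrow>
     (real \<Rightarrow> real \<Rightarrow> 'a set \<Rightarrow> 'b set) \<Rightarrow> bool" where
  "natural_shift \<epsilon> X f Y g \<alpha> \<longleftrightarrow>
     (\<forall>a b. a < b \<longrightarrow> \<alpha> a b ` reeb_pi0 X f a b \<subseteq> reeb_pi0 Y g (a - \<epsilon>) (b + \<epsilon>)) \<and>
     (\<forall>a b c d. a < b \<and> c \<le> a \<and> b \<le> d \<longrightarrow>
        (\<forall>C \<in> reeb_pi0 X f a b.
           \<alpha> c d (reeb_pi0_map X f c d C) = reeb_pi0_map Y g (c - \<epsilon>) (d + \<epsilon>) (\<alpha> a b C)))"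

definition interleaving ::
    "real \<Rightarrow> 'a::topological_space set \<Rightarrow> ('a \<Rightarrow> real) \<Rightarrow> 'b::topological_space set \<Rightarrow> ('b \<Rightarrow> real) \<Rightarrow>
     (real \<Rightarrow> real \<Rightarrow> 'a set \<Rightarrow> 'b set) \<Rightarrow> (real \<Rightarrow> real \<Rightarrow> 'b set \<Rightarrow> 'a set) \<Rightarrow> bool" where
  "interleaving \<epsilon> X f Y g \<alpha> \<beta> \<longleftrightarrow>
     natural_shift \<epsilon> X f Y g \<alpha> \<and> natural_shift \<epsilon> Y g X f \<beta> \<and>
     (\<forall>a b. a < b \<longrightarrow>
        (\<forall>C \<in> reeb_pi0 X f a b.
           \<beta> (a - \<epsilon>) (b + \<epsilon>) (\<alpha> a b C) = reeb_pi0_map X f (a - 2 * \<epsilon>) (b + 2 * \<epsilon>) C) \<and>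
        (\<forall>C \<in> reeb_pi0 Y g a b.
           \<alpha> (a - \<epsilon>) (b + \<epsilon>) (\<beta> a b C) = reeb_pi0_map Y g (a - 2 * \<epsilon>) (b + 2 * \<epsilon>) C))"

text \<open>Extended reals, so that the distance is \<open>\<infinity>\<close> when no interleaving exists.\<close>

definition d_I ::
    "'a::topological_space set \<Rightarrow> ('a \<Rightarrow> real) \<Rightarrow> 'b::topological_space set \<Rightarrow> ('b \<Rightarrow> real) \<Rightarrow> ereal" where
  "d_I X f Y g = Inf {ereal \<epsilon> | \<epsilon>. 0 \<le> \<epsilon> \<and> (\<exists>\<alpha> \<beta>. interleaving \<epsilon> X f Y g \<alpha> \<beta>)}"

end

theory Submission imports Defs begin

text \<open>
  Let \<open>\<epsilon>\<close> exceed the functional distortion of \<open>(\<phi>, \<psi>)\<close>. Taking images under \<open>\<phi>\<close> and \<open>\<psi>\<close> gives natural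
  maps of components that widen intervals by \<open>\<epsilon>\<close>. Since \<open>(x, \<phi> x)\<close> and \<open>(\<psi> (\<phi> x), \<phi> x)\<close> both lie in
  \<open>G(\<phi>, \<psi>)\<close>, the distance from \<open>x\<close> to \<open>\<psi> (\<phi> x)\<close> is below \<open>2\<epsilon>\<close>, so the two points lie in a common
  component over an interval of length less than \<open>2\<epsilon>\<close> around \<open>f x\<close>; hence the maps form an
  \<open>\<epsilon>\<close>-interleaving.

  For the upper bound, project the circle to the interval and lift the interval to the upper
  semicircle. Both maps preserve the Reeb functions and \<open>G(\<phi>, \<psi>)\<close> is the graph of the projection.
  Two points of the circle with \<open>x\<close>-coordinates \<open>u \<le> v\<close> are joined over \<open>[-1, v]\<close> and over \<open>[u, 1]\<close>, so
  their distance is between \<open>v - u\<close> and \<open>v - u + 1\<close>.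
\<close>

section \<open>Path components over open intervals and the maps between them\<close>

text \<open>Names each component by a point in it, so that maps on components can be computed by
  following points.\<close>

lemma reeb_pi0_eq:
  "reeb_pi0 X f a b = path_component_set (preim X f {a<..<b}) ` preim X f {a<..<b}"
proof -
  have "path_component_of (top_of_set S) x y \<longleftrightarrow> path_component S x y" for S :: "'a set" and x y
    by (simp add: path_component_of_def path_component_def pathin_def path_def
        continuous_map_in_subtopology image_subset_iff_funcset path_image_def pathstart_def pathfinish_def
        continuous_map_iff_continuous2)
  then have "path_component_of (top_of_set S) = path_component S" for S :: "'a set"
    by (simp add: fun_eq_iff)
  then show ?thesis
    by (simp add: reeb_pi0_def path_components_of_def)
qed

lemma reeb_pi0_map_eq:
  assumes "path_connected C" "C \<subseteq> preim X f {c<..<d}" "x \<in> C"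
  shows "reeb_pi0_map X f c d C = path_component_set (preim X f {c<..<d}) x"
  unfolding reeb_pi0_map_def
proof (rule the_equality)
  have "C \<subseteq> path_component_set (preim X f {c<..<d}) x"
    using path_component_maximal[OF assms(3,1,2)] .
  moreover have "path_component_set (preim X f {c<..<d}) x \<in> reeb_pi0 X f c d"
    unfolding reeb_pi0_eq using assms(2,3) by blast
  ultimately show "path_component_set (preim X f {c<..<d}) x \<in> reeb_pi0 X f c d \<and>
      C \<subseteq> path_component_set (preim X f {c<..<d}) x" by blast
next
  fix D assume D: "D \<in> reeb_pi0 X f c d \<and> C \<subseteq> D"
  then obtain y where "D = path_component_set (preim X f {c<..<d}) y"
    unfolding reeb_pi0_eq by blast
  moreover from this have "path_component (preim X f {c<..<d}) y x"
    using D assms(3) by blast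
  ultimately show "D = path_component_set (preim X f {c<..<d}) x"
    by (metis path_component_eq mem_Collect_eq)
qed

lemma reeb_pi0_map_component:
  assumes "x \<in> preim X f {a<..<b}" "c \<le> a" "b \<le> d"
  shows "reeb_pi0_map X f c d (path_component_set (preim X f {a<..<b}) x) =
    path_component_set (preim X f {c<..<d}) x"
proof (rule reeb_pi0_map_eq)
  have "preim X f {a<..<b} \<subseteq> preim X f {c<..<d}" using assms(2,3) by auto
  then show "path_component_set (preim X f {a<..<b}) x \<subseteq> preim X f {c<..<d}"
    using path_component_subset by (rule order_trans[rotated])
  show "x \<in> path_component_set (preim X f {a<..<b}) x"
    using assms(1) by (simp add: path_component_refl)
qed (rule path_connected_path_component)

text \<open>The continuous image of a component is path-connected, and moving function values by
  less than \<open>\<epsilon>\<close> keeps it over the widened interval. Here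
  \<open>reeb_pi0_map\<close> serves as "the component containing this set".\<close>

lemma reeb_pi0_map_image_component:
  assumes "continuous_on X \<phi>" "\<phi> ` X \<subseteq> Y" "\<And>x. x \<in> X \<Longrightarrow> \<bar>f x - g (\<phi> x)\<bar> < \<epsilon>"
    and "x \<in> preim X f {a<..<b}"
  shows "reeb_pi0_map Y g (a - \<epsilon>) (b + \<epsilon>) (\<phi> ` path_component_set (preim X f {a<..<b}) x) =
    path_component_set (preim Y g {a - \<epsilon><..<b + \<epsilon>}) (\<phi> x)"
proof (rule reeb_pi0_map_eq)
  have sub: "path_component_set (preim X f {a<..<b}) x \<subseteq> preim X f {a<..<b}"
    by (rule path_component_subset)
  show "path_connected (\<phi> ` path_component_set (preim X f {a<..<b}) x)"
    using sub by (intro path_connected_continuous_image path_connected_path_component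
        continuous_on_subset[OF assms(1)]) auto
  have "a - \<epsilon> < g (\<phi> y) \<and> g (\<phi> y) < b + \<epsilon>" if "y \<in> X" "a < f y" "f y < b" for y
    using assms(3)[OF that(1)] that by linarith
  then have "\<phi> ` preim X f {a<..<b} \<subseteq> preim Y g {a - \<epsilon><..<b + \<epsilon>}"
    using assms(2) by auto
  then show "\<phi> ` path_component_set (preim X f {a<..<b}) x \<subseteq> preim Y g {a - \<epsilon><..<b + \<epsilon>}"
    using image_mono[OF sub] by (rule order_trans[rotated])
  show "\<phi> x \<in> \<phi> ` path_component_set (preim X f {a<..<b}) x"
    using assms(4) by (auto simp: path_component_refl)
qed

text \<open>Both ways around the naturality square send the component of \<open>x\<close> to the
  component of \<open>\<phi> x\<close> over the larger widened interval.\<close>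

lemma natural_shift_image:
  assumes "continuous_on X \<phi>" "\<phi> ` X \<subseteq> Y" "\<And>x. x \<in> X \<Longrightarrow> \<bar>f x - g (\<phi> x)\<bar> < \<epsilon>"
  shows "natural_shift \<epsilon> X f Y g (\<lambda>a b C. reeb_pi0_map Y g (a - \<epsilon>) (b + \<epsilon>) (\<phi> ` C))"
proof -
  have near: "\<phi> x \<in> preim Y g {a - \<epsilon><..<b + \<epsilon>}" if "x \<in> preim X f {a<..<b}" for x a b
    using that assms(2) assms(3)[of x] by (auto simp: image_subset_iff)
  show ?thesis
    unfolding natural_shift_def
  proof (intro conjI allI impI ballI)
    fix a b :: real
    show "(\<lambda>C. reeb_pi0_map Y g (a - \<epsilon>) (b + \<epsilon>) (\<phi> ` C)) ` reeb_pi0 X f a b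
      \<subseteq> reeb_pi0 Y g (a - \<epsilon>) (b + \<epsilon>)"
    proof
      fix D assume "D \<in> (\<lambda>C. reeb_pi0_map Y g (a - \<epsilon>) (b + \<epsilon>) (\<phi> ` C)) ` reeb_pi0 X f a b"
      then obtain x where x: "x \<in> preim X f {a<..<b}"
        "D = reeb_pi0_map Y g (a - \<epsilon>) (b + \<epsilon>) (\<phi> ` path_component_set (preim X f {a<..<b}) x)"
        unfolding reeb_pi0_eq by blast
      then show "D \<in> reeb_pi0 Y g (a - \<epsilon>) (b + \<epsilon>)"
        using reeb_pi0_map_image_component[OF assms x(1)] near[OF x(1)]
        unfolding reeb_pi0_eq by blast
    qed
  next
    fix a b c d C assume ab: "a < b \<and> c \<le> a \<and> b \<le> d" and "C \<in> reeb_pi0 X f a b"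
    then obtain x where x: "x \<in> preim X f {a<..<b}" "C = path_component_set (preim X f {a<..<b}) x"
      unfolding reeb_pi0_eq by blast
    have x': "x \<in> preim X f {c<..<d}" using x(1) ab by auto
    have "reeb_pi0_map X f c d C = path_component_set (preim X f {c<..<d}) x"
      using reeb_pi0_map_component[OF x(1)] ab x(2) by auto
    moreover have "reeb_pi0_map Y g (c - \<epsilon>) (d + \<epsilon>)
        (path_component_set (preim Y g {a - \<epsilon><..<b + \<epsilon>}) (\<phi> x)) =
      path_component_set (preim Y g {c - \<epsilon><..<d + \<epsilon>}) (\<phi> x)"
      by (rule reeb_pi0_map_component[OF near[OF x(1)]]) (use ab in auto)
    ultimately show "reeb_pi0_map Y g (c - \<epsilon>) (d + \<epsilon>) (\<phi> ` reeb_pi0_map X f c d C) =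
        reeb_pi0_map Y g (c - \<epsilon>) (d + \<epsilon>) (reeb_pi0_map Y g (a - \<epsilon>) (b + \<epsilon>) (\<phi> ` C))"
      using reeb_pi0_map_image_component[OF assms x'] reeb_pi0_map_image_component[OF assms x(1)] x(2)
      by simp
  qed
qed

section \<open>The Reeb metric\<close>

text \<open>All of \<open>X\<close> lies over \<open>[-B, B]\<close> for a bound \<open>B\<close> of
  \<open>f\<close>. This keeps the real infimum in \<open>reeb_dist\<close> meaningful.\<close>

lemma reeb_dist_set_nonempty:
  assumes "connected X" "bounded (f ` X)" "x \<in> X" "y \<in> X"
  shows "{b - a | a b. connected_component (preim X f {a..b}) x y} \<noteq> {}"
proof -
  obtain B where B: "\<And>z. z \<in> X \<Longrightarrow> \<bar>f z\<bar> \<le> B"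
    using assms(2) by (auto simp: bounded_iff)
  have "preim X f {-B..B} = X" using B by (fastforce simp: abs_le_iff)
  then have "connected_component (preim X f {-B..B}) x y"
    using assms by (simp add: connected_iff_connected_component)
  then show ?thesis by blast
qed

text \<open>Any interval over which \<open>x\<close> and \<open>y\<close> share a component contains
  both \<open>f x\<close> and \<open>f y\<close>.\<close>

lemma reeb_dist_lower:
  assumes "connected X" "bounded (f ` X)" "x \<in> X" "y \<in> X"
  shows "\<bar>f x - f y\<bar> \<le> reeb_dist X f x y"
  unfolding reeb_dist_def
proof (rule cInf_greatest[OF reeb_dist_set_nonempty[OF assms]])
  fix r assume "r \<in> {b - a | a b. connected_component (preim X f {a..b}) x y}"
  then obtain a b where "r = b - a" "connected_component (preim X f {a..b}) x y" by blast
  then show "\<bar>f x - f y\<bar> \<le> r"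
    using connected_component_in by fastforce
qed

lemma reeb_dist_upper:
  assumes "connected_component (preim X f {a..b}) x y"
  shows "reeb_dist X f x y \<le> b - a"
  unfolding reeb_dist_def
proof (rule cInf_lower)
  show "bdd_below {b - a | a b. connected_component (preim X f {a..b}) x y}"
    by (rule bdd_belowI[where m = 0]) (use connected_component_in in fastforce)
qed (use assms in blast)

lemma reeb_dist_less:
  assumes "connected X" "bounded (f ` X)" "x \<in> X" "y \<in> X" "reeb_dist X f x y < r"
  obtains a b where "b - a < r" "connected_component (preim X f {a..b}) x y"
  using cInf_lessD[OF reeb_dist_set_nonempty[OF assms(1-4)] assms(5)[unfolded reeb_dist_def]] that
  by blast

text \<open>An interval of length below \<open>2 * \<epsilon>\<close> that contains
  \<open>f x\<close> fits inside the widened open interval. The metric speaks of connected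
  components and \<open>reeb_pi0\<close> of path components; they agree over an open interval
  because its preimage is open in the locally path-connected \<open>X\<close>.\<close>

lemma path_component_preim_eq:
  fixes X :: "'a::topological_space set"
  assumes X: "connected X" "bounded (f ` X)" "locally path_connected X" "continuous_on X f"
    and x: "x \<in> preim X f {a<..<b}" and y: "y \<in> X" and d: "reeb_dist X f x y < 2 * \<epsilon>"
  shows "path_component_set (preim X f {a - 2 * \<epsilon><..<b + 2 * \<epsilon>}) y =
    path_component_set (preim X f {a - 2 * \<epsilon><..<b + 2 * \<epsilon>}) x"
proof -
  let ?S = "preim X f {a - 2 * \<epsilon><..<b + 2 * \<epsilon>}"
  obtain a' b' where ab: "b' - a' < 2 * \<epsilon>" and c: "connected_component (preim X f {a'..b'}) x y"
    using reeb_dist_less[OF X(1,2) _ y d] x by blast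
  have "f x \<in> {a'..b'}" using connected_component_in[OF c] by auto
  then have "{a'..b'} \<subseteq> {a - 2 * \<epsilon><..<b + 2 * \<epsilon>}" using x ab by auto
  then have "connected_component ?S x y"
    using connected_component_mono[of "preim X f {a'..b'}" ?S x] c by blast
  moreover have "openin (top_of_set X) ?S"
    using continuous_openin_preimage_gen[OF X(4) open_greaterThanLessThan]
    by (simp add: vimage_def Int_def)
  then have "locally path_connected ?S"
    using X(3) locally_open_subset by blast
  ultimately have "path_component ?S x y"
    using path_component_eq_connected_component by metis
  then show ?thesis by (simp add: path_component_eq path_component_sym)
qed

text \<open>The degenerate interval \<open>[f x, f x]\<close> attains the infimum.\<close>

lemma reeb_dist_refl:
  assumes "x \<in> X"
  shows "reeb_dist X f x x = 0"
proof (rule antisym)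
  have cc: "connected_component (preim X f {f x..f x}) x x" using assms by simp
  then show "reeb_dist X f x x \<le> 0" using reeb_dist_upper[of X f "f x" "f x" x x] by simp
  have "{b - a | a b. connected_component (preim X f {a..b}) x x} \<noteq> {}"
    using cc by blast
  then show "0 \<le> reeb_dist X f x x"
    unfolding reeb_dist_def
    by (rule cInf_greatest) (use connected_component_in in fastforce)
qed

section \<open>Interleavings from functional distortion\<close>

lemma d_I_le_d_FD:
  fixes X :: "'a::topological_space set" and Y :: "'b::topological_space set"
  assumes X: "connected X" "bounded (f ` X)" "locally path_connected X" "continuous_on X f"
    and Y: "connected Y" "bounded (g ` Y)" "locally path_connected Y" "continuous_on Y g"
    and ne: "X \<noteq> {}"
  shows "d_I X f Y g \<le> d_FD X f Y g"
proof (rule ccontr)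
  assume "\<not> ?thesis"
  then have "d_FD X f Y g < d_I X f Y g" by simp
  \<comment> \<open>A real number strictly between the two distances makes all bounds below strict,
    as the open intervals require.\<close>
  then obtain \<epsilon> where e: "d_FD X f Y g < ereal \<epsilon>" "ereal \<epsilon> < d_I X f Y g"
    using ereal_dense2 by blast
  then obtain \<phi> \<psi> where \<phi>: "continuous_on X \<phi>" "\<phi> ` X \<subseteq> Y" and \<psi>: "continuous_on Y \<psi>" "\<psi> ` Y \<subseteq> X"
    and m: "fd_distortion X f Y g \<phi> \<psi> < ereal \<epsilon>" "sup_dist X f (g \<circ> \<phi>) < ereal \<epsilon>"
      "sup_dist Y (f \<circ> \<psi>) g < ereal \<epsilon>"
    unfolding d_FD_def INF_less_iff by auto
  have f\<phi>: "\<bar>f x - g (\<phi> x)\<bar> < \<epsilon>" if "x \<in> X" for x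
    using m(2) SUP_lessD[of _ X] that unfolding sup_dist_def by fastforce
  have g\<psi>: "\<bar>g y - f (\<psi> y)\<bar> < \<epsilon>" if "y \<in> Y" for y
    using m(3) SUP_lessD[of _ Y] that unfolding sup_dist_def
    by (fastforce simp: abs_minus_commute)
  have dis: "\<bar>reeb_dist X f p p' - reeb_dist Y g q q'\<bar> < 2 * \<epsilon>"
    if "(p, q) \<in> graph_corr X Y \<phi> \<psi>" "(p', q') \<in> graph_corr X Y \<phi> \<psi>" for p q p' q'
  proof -
    have "ereal (1 / 2 * \<bar>reeb_dist X f p p' - reeb_dist Y g q q'\<bar>) < ereal \<epsilon>"
      using SUP_lessD[OF m(1)[unfolded fd_distortion_def], of "((p, q), (p', q'))"] that by simp
    then show ?thesis by simp
  qed
  \<comment> \<open>The two pairs share their second coordinate, so the term of \<open>Y\<close> in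
    the distortion vanishes.\<close>
  have dX: "reeb_dist X f x (\<psi> (\<phi> x)) < 2 * \<epsilon>" if "x \<in> X" for x
    using dis[of x "\<phi> x" "\<psi> (\<phi> x)" "\<phi> x"] reeb_dist_refl[of "\<phi> x" Y g] \<phi>(2) that
    by (fastforce simp: graph_corr_def)
  have dY: "reeb_dist Y g y (\<phi> (\<psi> y)) < 2 * \<epsilon>" if "y \<in> Y" for y
    using dis[of "\<psi> y" y "\<psi> y" "\<phi> (\<psi> y)"] reeb_dist_refl[of "\<psi> y" X f] \<psi>(2) that
    by (fastforce simp: graph_corr_def)
  define \<alpha> where "\<alpha> = (\<lambda>a b C. reeb_pi0_map Y g (a - \<epsilon>) (b + \<epsilon>) (\<phi> ` C))"
  define \<beta> where "\<beta> = (\<lambda>a b C. reeb_pi0_map X f (a - \<epsilon>) (b + \<epsilon>) (\<psi> ` C))"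
  have \<alpha>: "\<alpha> a b (path_component_set (preim X f {a<..<b}) x) =
      path_component_set (preim Y g {a - \<epsilon><..<b + \<epsilon>}) (\<phi> x)" if "x \<in> preim X f {a<..<b}" for a b x
    unfolding \<alpha>_def by (rule reeb_pi0_map_image_component[OF \<phi> f\<phi> that])
  have \<beta>: "\<beta> a b (path_component_set (preim Y g {a<..<b}) y) =
      path_component_set (preim X f {a - \<epsilon><..<b + \<epsilon>}) (\<psi> y)" if "y \<in> preim Y g {a<..<b}" for a b y
    unfolding \<beta>_def by (rule reeb_pi0_map_image_component[OF \<psi> g\<psi> that])
  \<comment> \<open>If \<open>X\<close> and \<open>Y\<close> were both empty, all suprema would be
    \<open>-\<infinity>\<close> and \<open>\<epsilon>\<close> could be negative; a point of
    \<open>X\<close> excludes this.\<close>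
  obtain x0 where "x0 \<in> X" using ne by blast
  then have e0: "0 \<le> \<epsilon>" using f\<phi>[of x0] by linarith
  have sh: "a - \<epsilon> - \<epsilon> = a - 2 * \<epsilon>" "b + \<epsilon> + \<epsilon> = b + 2 * \<epsilon>" for a b :: real by auto
  have "\<beta> (a - \<epsilon>) (b + \<epsilon>) (\<alpha> a b C) = reeb_pi0_map X f (a - 2 * \<epsilon>) (b + 2 * \<epsilon>) C"
    if C: "C \<in> reeb_pi0 X f a b" for a b C
  proof -
    obtain x where x: "x \<in> preim X f {a<..<b}" "C = path_component_set (preim X f {a<..<b}) x"
      using C unfolding reeb_pi0_eq by blast
    have "\<phi> x \<in> preim Y g {a - \<epsilon><..<b + \<epsilon>}" "\<psi> (\<phi> x) \<in> X"
      using x(1) \<phi>(2) \<psi>(2) f\<phi>[of x] by (auto simp: image_subset_iff)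
    \<comment> \<open>The composite yields the component of \<open>\<psi> (\<phi> x)\<close>, which
      by \<open>dX\<close> is that of \<open>x\<close>.\<close>
    then show ?thesis
      using x \<alpha>[OF x(1)] \<beta>[of "\<phi> x" "a - \<epsilon>" "b + \<epsilon>"] dX[of x]
        path_component_preim_eq[OF X x(1), of "\<psi> (\<phi> x)" \<epsilon>]
        reeb_pi0_map_component[OF x(1), of "a - 2 * \<epsilon>" "b + 2 * \<epsilon>"] e0
      by (simp add: sh)
  qed
  moreover have "\<alpha> (a - \<epsilon>) (b + \<epsilon>) (\<beta> a b C) = reeb_pi0_map Y g (a - 2 * \<epsilon>) (b + 2 * \<epsilon>) C"
    if C: "C \<in> reeb_pi0 Y g a b" for a b C
  proof -
    obtain y where y: "y \<in> preim Y g {a<..<b}" "C = path_component_set (preim Y g {a<..<b}) y"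
      using C unfolding reeb_pi0_eq by blast
    have "\<psi> y \<in> preim X f {a - \<epsilon><..<b + \<epsilon>}" "\<phi> (\<psi> y) \<in> Y"
      using y(1) \<phi>(2) \<psi>(2) g\<psi>[of y] by (auto simp: image_subset_iff)
    then show ?thesis
      using y \<beta>[OF y(1)] \<alpha>[of "\<psi> y" "a - \<epsilon>" "b + \<epsilon>"] dY[of y]
        path_component_preim_eq[OF Y y(1), of "\<phi> (\<psi> y)" \<epsilon>]
        reeb_pi0_map_component[OF y(1), of "a - 2 * \<epsilon>" "b + 2 * \<epsilon>"] e0
      by (simp add: sh)
  qed
  moreover have "natural_shift \<epsilon> X f Y g \<alpha>"
    unfolding \<alpha>_def by (rule natural_shift_image[OF \<phi>]) (rule f\<phi>)
  moreover have "natural_shift \<epsilon> Y g X f \<beta>"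
    unfolding \<beta>_def by (rule natural_shift_image[OF \<psi>]) (rule g\<psi>)
  ultimately have "interleaving \<epsilon> X f Y g \<alpha> \<beta>"
    unfolding interleaving_def by blast
  then have "d_I X f Y g \<le> ereal \<epsilon>"
    unfolding d_I_def using e0 by (intro Inf_lower) blast
  then show False using e(2) by simp
qed

section \<open>Reeb metrics of the circle and of the interval\<close>

text \<open>\<open>sqrt\<close> is continuous on the whole real line. The values 1 and -1 of
  \<open>s\<close> give the upper and lower arcs.\<close>

lemma connected_graph_semicircle:
  fixes s u v :: real
  shows "connected ((\<lambda>t. (t, s * sqrt (1 - t\<^sup>2))) ` {u..v})"
  by (intro connected_continuous_image continuous_intros) auto

text \<open>The factors 1 and -1 are written out so that both arcs match
  \<open>connected_graph_semicircle\<close>.\<close>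

lemma circle_cap_eq_graphs:
  "preim {(x, y). x\<^sup>2 + y\<^sup>2 = 1} fst {a..b} =
    (\<lambda>t. (t, 1 * sqrt (1 - t\<^sup>2))) ` {max a (-1)..min b 1} \<union>
    (\<lambda>t. (t, (-1) * sqrt (1 - t\<^sup>2))) ` {max a (-1)..min b (1::real)}" (is "?L = ?R")
proof
  show "?L \<subseteq> ?R"
  proof
    fix p assume "p \<in> ?L"
    then obtain x y where p: "p = (x, y)" "x\<^sup>2 + y\<^sup>2 = 1" "a \<le> x" "x \<le> b" by (cases p) auto
    then have "y\<^sup>2 = 1 - x\<^sup>2" by simp
    then have y: "\<bar>y\<bar> = sqrt (1 - x\<^sup>2)" by (metis real_sqrt_abs)
    have "x\<^sup>2 \<le> 1" using p(2) zero_le_power2[of y] by linarith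
    then have "\<bar>x\<bar> \<le> 1" by (simp add: abs_square_le_1)
    then have "x \<in> {max a (-1)..min b 1}" using p by auto
    then show "p \<in> ?R" using p(1) y by (cases "0 \<le> y") (auto intro!: image_eqI[of _ _ x])
  qed
  have "t\<^sup>2 \<le> 1" if "t \<in> {max a (-1)..min b 1}" for t
    using that by (simp add: abs_square_le_1 abs_le_iff)
  then show "?R \<subseteq> ?L" by auto
qed

text \<open>The assumption puts -1 or 1 into \<open>[a, b]\<close>; there the square root vanishes
  and the two arcs meet.\<close>

lemma connected_circle_cap:
  assumes "a \<le> -1 \<and> -1 \<le> b \<or> a \<le> 1 \<and> 1 \<le> (b::real)"
  shows "connected (preim {(x, y). x\<^sup>2 + y\<^sup>2 = (1::real)} fst {a..b})"
  unfolding circle_cap_eq_graphs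
proof (rule connected_Un[OF connected_graph_semicircle connected_graph_semicircle])
  let ?I = "{max a (-1)..min b 1}"
  have "-1 \<in> ?I \<or> 1 \<in> ?I" using assms by auto
  then have "\<exists>t\<in>?I. sqrt (1 - t\<^sup>2) = 0" by force
  then show "(\<lambda>t. (t, 1 * sqrt (1 - t\<^sup>2))) ` ?I \<inter> (\<lambda>t. (t, (-1) * sqrt (1 - t\<^sup>2))) ` ?I \<noteq> {}"
    by force
qed

lemma reeb_dist_circle_le:
  assumes "p \<in> {(x, y). x\<^sup>2 + y\<^sup>2 = (1::real)}" "q \<in> {(x, y). x\<^sup>2 + y\<^sup>2 = 1}"
  shows "reeb_dist {(x, y). x\<^sup>2 + y\<^sup>2 = 1} fst p q \<le> \<bar>fst p - fst q\<bar> + 1"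
proof -
  let ?C = "{(x, y). x\<^sup>2 + y\<^sup>2 = (1::real)}"
  have bound: "\<bar>fst z\<bar> \<le> 1" if "z \<in> ?C" for z
  proof -
    have "(fst z)\<^sup>2 + (snd z)\<^sup>2 = 1" using that by auto
    then have "(fst z)\<^sup>2 \<le> 1" using zero_le_power2[of "snd z"] by linarith
    then show ?thesis by (simp add: abs_square_le_1)
  qed
  define u v where "u = min (fst p) (fst q)" and "v = max (fst p) (fst q)"
  have cc: "reeb_dist ?C fst p q \<le> b - a"
    if "a \<le> -1 \<and> -1 \<le> b \<or> a \<le> 1 \<and> 1 \<le> b" "a \<le> u" "v \<le> b" for a b
  proof (rule reeb_dist_upper)
    have "p \<in> preim ?C fst {a..b}" "q \<in> preim ?C fst {a..b}"
      using assms that by (auto simp: u_def v_def)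
    then show "connected_component (preim ?C fst {a..b}) p q"
      using connected_circle_cap[OF that(1)] by (simp only: connected_iff_connected_component)
  qed
  have uv: "\<bar>u\<bar> \<le> 1" "\<bar>v\<bar> \<le> 1" "\<bar>fst p - fst q\<bar> = v - u" "u \<le> v"
    using bound[OF assms(1)] bound[OF assms(2)] by (auto simp: u_def v_def)
  show ?thesis
  \<comment> \<open>The interval \<open>[-1, v]\<close> exceeds \<open>v - u\<close> by
    \<open>u + 1\<close>, and \<open>[u, 1]\<close> exceeds it by \<open>1 - v\<close>. The sign of
    \<open>u\<close> selects one whose excess is at most 1.\<close>
  proof (cases "u \<le> 0")
    case True
    then show ?thesis using cc[of "-1" v] uv by auto
  next
    case False
    then show ?thesis using cc[of u 1] uv by auto
  qed
qed

lemma reeb_dist_interval: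
  assumes "p \<in> {-1..1}" "q \<in> {-1..1::real}"
  shows "reeb_dist {-1..1} (\<lambda>t. t) p q = \<bar>p - q\<bar>"
proof (rule antisym)
  have "preim {-1..1} (\<lambda>t. t) {min p q..max p q} = {min p q..max p q}" using assms by auto
  moreover have "connected_component {min p q..max p q} p q"
    using connected_Icc[of "min p q" "max p q"]
    unfolding connected_iff_connected_component by auto
  ultimately have "reeb_dist {-1..1} (\<lambda>t. t) p q \<le> max p q - min p q"
    by (intro reeb_dist_upper) simp
  then show "reeb_dist {-1..1} (\<lambda>t. t) p q \<le> \<bar>p - q\<bar>" by linarith
  show "\<bar>p - q\<bar> \<le> reeb_dist {-1..1} (\<lambda>t. t) p q"
    by (rule reeb_dist_lower[of "{-1..1}" "\<lambda>t. t" p q]) (use assms in auto)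
qed

section \<open>Distances between the circle and the interval\<close>

theorem proposition3p9:
  fixes Rf :: "(real \<times> real) set" and f :: "real \<times> real \<Rightarrow> real"
    and Rg :: "real set" and g :: "real \<Rightarrow> real"
  assumes "Rf = {(x, y). x\<^sup>2 + y\<^sup>2 = 1}" and "f = (\<lambda>(x, y). x)"
    and "Rg = {-1..1}" and "g = (\<lambda>t. t)"
  shows "d_I Rf f Rg g \<le> d_FD Rf f Rg g \<and> d_FD Rf f Rg g \<le> ereal (1 / 2)"
proof
  have f: "f = fst" using assms(2) by (auto simp: fun_eq_iff)
  \<comment> \<open>As a Euclidean sphere, the circle is connected, bounded and an ANR, hence
    locally path-connected.\<close>
  have sphere: "Rf = sphere 0 1"
    unfolding assms(1) by (auto simp: norm_prod_def)
  have "2 \<le> DIM(real \<times> real)" by simp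
  then have conn: "connected Rf" unfolding sphere by (rule connected_sphere)
  have bdd: "bounded (fst ` Rf)"
    unfolding sphere by (intro bounded_fst bounded_sphere)
  have abs1: "\<bar>fst p\<bar> \<le> 1" if "p \<in> Rf" for p
    using that norm_fst_le[of "fst p" "snd p"] by (auto simp: sphere)
  have ne: "Rf \<noteq> {}" unfolding sphere by simp
  show "d_I Rf f Rg g \<le> d_FD Rf f Rg g"
  proof (rule d_I_le_d_FD)
    show "locally path_connected Rf" unfolding sphere
      by (intro ANR_imp_locally_path_connected ANR_sphere)
    show "locally path_connected Rg" unfolding assms(3)
      by (intro convex_imp_locally_path_connected) simp
    show "continuous_on Rf f" unfolding f by (intro continuous_intros)
    show "bounded (f ` Rf)" unfolding f by (rule bdd)
  qed (use conn ne assms(3,4) in auto)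
  define \<psi> :: "real \<Rightarrow> real \<times> real" where "\<psi> = (\<lambda>t. (t, sqrt (1 - t\<^sup>2)))"
  have \<psi>: "continuous_on Rg \<psi>" unfolding \<psi>_def by (intro continuous_intros)
  have \<psi>Rf: "\<psi> t \<in> Rf" if "t \<in> Rg" for t
  proof -
    have "t\<^sup>2 \<le> 1" using that assms(3) by (simp add: abs_square_le_1 abs_le_iff)
    then show ?thesis by (simp add: assms(1) \<psi>_def)
  qed
  have fRg: "fst ` Rf \<subseteq> Rg" using abs1 assms(3) by (fastforce simp: abs_le_iff)
  \<comment> \<open>Since \<open>fst (\<psi> t) = t\<close>, the pairs coming from
    \<open>\<psi>\<close> already lie on the graph of \<open>fst\<close>.\<close>
  have corr: "p \<in> Rf \<and> q = fst p" if "(p, q) \<in> graph_corr Rf Rg fst \<psi>" for p q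
    using that \<psi>Rf by (auto simp: graph_corr_def \<psi>_def)
  have "fd_distortion Rf f Rg g fst \<psi> \<le> ereal (1 / 2)"
    unfolding fd_distortion_def
  proof (rule SUP_least, clarify)
    fix p q p' q'
    assume "(p, q) \<in> graph_corr Rf Rg fst \<psi>" "(p', q') \<in> graph_corr Rf Rg fst \<psi>"
    then have pq: "p \<in> Rf" "q = fst p" "p' \<in> Rf" "q' = fst p'" using corr by auto
    have "reeb_dist Rg g q q' = \<bar>fst p - fst p'\<bar>"
      using reeb_dist_interval[of q q'] fRg pq unfolding assms(3,4) by blast
    moreover have "\<bar>fst p - fst p'\<bar> \<le> reeb_dist Rf f p p'"
      unfolding f by (rule reeb_dist_lower[OF conn bdd pq(1,3)])
    moreover have "reeb_dist Rf f p p' \<le> \<bar>fst p - fst p'\<bar> + 1"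
      using reeb_dist_circle_le pq(1,3) unfolding f assms(1) by blast
    \<comment> \<open>The two metrics differ by a number between 0 and 1, which the factor 1/2 in
      the distortion halves.\<close>
    ultimately show "ereal (1 / 2 * \<bar>reeb_dist Rf f p p' - reeb_dist Rg g q q'\<bar>) \<le> ereal (1 / 2)"
      by auto
  qed
  \<comment> \<open>Both maps preserve the Reeb functions, so every term of these suprema is
    0.\<close>
  moreover have "sup_dist Rf f (g \<circ> fst) \<le> ereal (1 / 2)" "sup_dist Rg (f \<circ> \<psi>) g \<le> ereal (1 / 2)"
    unfolding sup_dist_def by (auto intro!: SUP_least simp: f assms(4) \<psi>_def)
  ultimately have "Max {fd_distortion Rf f Rg g fst \<psi>, sup_dist Rf f (g \<circ> fst), sup_dist Rg (f \<circ> \<psi>) g}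
      \<le> ereal (1 / 2)" by simp
  moreover have "continuous_on Rf fst" by (intro continuous_intros)
  ultimately show "d_FD Rf f Rg g \<le> ereal (1 / 2)"
    unfolding d_FD_def using \<psi> \<psi>Rf fRg
    by (intro INF_lower2[of "(fst, \<psi>)"]) (auto simp: image_subset_iff)
qed

end
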